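(* There is a constant $C_\mu\in\mathbb{R}$ such that for all $f\in C^1(\Omega)$ $$\mathrm{Var}_\mu(f)\le C_\mu\left(\int_\Omega|\nabla f|^2\,\alpha\,d\lambda+\int_{\partial\Omega}|\nabla^\tau f|^2\,\beta\,d\sigma\right).$$
   Context: Setting and notation. $\Omega$ is a smooth compact connected Riemannian manifold of dimension $d\ge2$ with smooth connected boundary $\partial\Omega$ (the boundary is included in $\Omega$). $\lambda$ is the volume measure on $\Omega$, $\sigma$ the Hausdorff (surface) measure on $\partial\Omega$, $\nabla$ the gradient on $\Omega$, $\nabla^\tau$ the tangential gradient on $\partial\Omega$. $C^1(\Omega)$ denotes functions that are $C^1$ up to the boundary; integrals over $\partial\Omega$ of functions on $\Omega$ use their restriction (trace). $\alpha,\beta:\Omega\to\mathbb{R}$ are weights, $A:=\int_\Omega\alpha\,d\lambda$, $B:=\int_{\partial\Omega}\beta\,d\sigma$, $d\lambda_\alpha:=\frac{\alpha}{A}d\lambda$, $d\sigma_\beta:=\frac{\beta}{B}d\sigma$, $d\mu:=\alpha\,d\lambda+\beta\,d\sigma$. For a probability measure $\nu$: $\mathrm{Var}_\nu(f)=\int f^2d\nu-(\int f\,d\nu)^2$ and $\mathrm{Ent}_\nu(f^2)=\int f^2\ln(f^2)d\nu-\int f^2d\nu\,\ln\int f^2d\nu$. Standing assumptions. (1) $\mu$ is a probability measure, with $A,B\in(0,1)$, $A+B=1$. (2) $\alpha,\beta\in C(\Omega)$, $\alpha>0$ $\lambda$-a.e. on $\Omega$, $\beta>0$ $\sigma$-a.e.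 on $\partial\Omega$, $\sqrt\alpha\in W^{1,2}(\Omega)$, $\sqrt\beta\in W^{1,2}(\partial\Omega)$. (3) The constants $C_{\lambda_\alpha},L_{\lambda_\alpha},C_{\sigma_\beta},L_{\sigma_\beta}$ are finite, where these are the smallest constants with $\mathrm{Var}_{\lambda_\alpha}(f)\le C_{\lambda_\alpha}\int_\Omega|\nabla f|^2d\lambda_\alpha$ and $\mathrm{Ent}_{\lambda_\alpha}(f^2)\le L_{\lambda_\alpha}\int_\Omega|\nabla f|^2d\lambda_\alpha$ for all $f\in C^1(\Omega)$, and $\mathrm{Var}_{\sigma_\beta}(f)\le C_{\sigma_\beta}\int_{\partial\Omega}|\nabla^\tau f|^2d\sigma_\beta$ and $\mathrm{Ent}_{\sigma_\beta}(f^2)\le L_{\sigma_\beta}\int_{\partial\Omega}|\nabla^\tau f|^2d\sigma_\beta$ for all $f\in C^1(\partial\Omega)$. (4) The following embeddings/traces hold: $W^{1,2}(\Omega,\alpha d\lambda)\to L^2(\Omega,\alpha d\lambda)$ compactly; $W^{1,2}(\Omega,\alpha d\lambda)\to L^p(\Omega,\beta d\lambda)$ for $p\in[2,\frac{2d-2}{d-2}]$; $W^{1,2}(\partial\Omega,\beta d\sigma)\to L^2(\partial\Omega,\beta d\sigma)$ compactly; the trace $W^{1,2}(\Omega,\alpha d\lambda)\to L^2(\partial\Omega,\beta d\sigma)$ compactly. *)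

theory Defs
  imports "HOL-Probability.Probability"
begin

section \<open>Smooth manifolds with boundary and Riemannian metrics\<close>

text \<open>Derivatives are taken within \<open>S\<close>. On an open subset of a half-space this is
  differentiability up to the boundary; the derivative within \<open>S\<close> is unique there.\<close>

primrec Ck_on :: "nat \<Rightarrow> 'e::real_normed_vector set \<Rightarrow> ('e \<Rightarrow> 'f::real_normed_vector) \<Rightarrow> bool" where
  "Ck_on 0 S f \<longleftrightarrow> continuous_on S f"
| "Ck_on (Suc k) S f \<longleftrightarrow>
     (\<exists>f'. (\<forall>x\<in>S. (f has_derivative f' x) (at x within S)) \<and> (\<forall>v. Ck_on k S (\<lambda>x. f' x v)))"

definition smooth_on :: "'e::real_normed_vector set \<Rightarrow> ('e \<Rightarrow> 'f::real_normed_vector) \<Rightarrow> bool" where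
  "smooth_on S f \<longleftrightarrow> (\<forall>k. Ck_on k S f)"

text \<open>A chart together with the coefficients of the metric in that chart: \<open>chart_metric c p v w\<close>
  is \<open>g\<^sub>p(v, w)\<close> for the tangent vectors at \<open>p\<close> with coordinates \<open>v\<close>, \<open>w\<close> in \<open>c\<close>.\<close>

datatype ('a, 'e) rchart =
  RChart (chart_dom: "'a set") (chart_map: "'a \<Rightarrow> 'e") (chart_metric: "'a \<Rightarrow> 'e \<Rightarrow> 'e \<Rightarrow> real")

definition chart_inv :: "('a, 'e) rchart \<Rightarrow> 'e \<Rightarrow> 'a" where
  "chart_inv c = inv_into (chart_dom c) (chart_map c)"

definition chart_img :: "('a, 'e) rchart \<Rightarrow> 'e set" where
  "chart_img c = chart_map c ` chart_dom c"

text \<open>\<open>H\<close> is the model space: a half-space for manifolds with boundary.\<close>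

definition riemannian_atlas ::
    "'e::euclidean_space set \<Rightarrow> 'a::t2_space set \<Rightarrow> ('a, 'e) rchart set \<Rightarrow> bool" where
  "riemannian_atlas H M \<A> \<longleftrightarrow>
     (\<Union>c\<in>\<A>. chart_dom c) = M \<and>
     (\<forall>c\<in>\<A>. openin (top_of_set M) (chart_dom c) \<and> openin (top_of_set H) (chart_img c) \<and>
        homeomorphism (chart_dom c) (chart_img c) (chart_map c) (chart_inv c)) \<and>
     (\<forall>c\<in>\<A>. \<forall>c'\<in>\<A>.
        smooth_on (chart_map c ` (chart_dom c \<inter> chart_dom c')) (chart_map c' \<circ> chart_inv c)) \<and>
     (\<forall>c\<in>\<A>. \<forall>p\<in>chart_dom c. bilinear (chart_metric c p) \<and>
        (\<forall>v w. chart_metric c p v w = chart_metric c p w v) \<and>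
        (\<forall>v. v \<noteq> 0 \<longrightarrow> 0 < chart_metric c p v v)) \<and>
     (\<forall>c\<in>\<A>. \<forall>v w. smooth_on (chart_img c) (\<lambda>x. chart_metric c (chart_inv c x) v w)) \<and>
     (\<forall>c\<in>\<A>. \<forall>c'\<in>\<A>. \<forall>p\<in>chart_dom c \<inter> chart_dom c'. \<forall>D v w.
        ((chart_map c' \<circ> chart_inv c) has_derivative D)
          (at (chart_map c p) within chart_map c ` (chart_dom c \<inter> chart_dom c')) \<longrightarrow>
        chart_metric c p v w = chart_metric c' p (D v) (D w))"

text \<open>The model of a \<open>d\<close>-dimensional manifold with boundary is the half-space of \<open>real \<times> 'b\<close>, so
  that \<open>d = DIM('b) + 1\<close> and the boundary is modelled on \<open>'b\<close>.\<close>

definition half_space :: "(real \<times> 'b::euclidean_space) set" where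
  "half_space = {x. 0 \<le> fst x}"

definition bdry :: "('a, real \<times> 'b::euclidean_space) rchart set \<Rightarrow> 'a set" where
  "bdry \<A> = {p. \<exists>c\<in>\<A>. p \<in> chart_dom c \<and> fst (chart_map c p) = 0}"

definition bdry_chart ::
    "('a, real \<times> 'b::euclidean_space) rchart \<Rightarrow> ('a, 'b) rchart" where
  "bdry_chart c = RChart {p \<in> chart_dom c. fst (chart_map c p) = 0} (snd \<circ> chart_map c)
     (\<lambda>p v w. chart_metric c p (0, v) (0, w))"

text \<open>The boundary as a Riemannian manifold with the induced metric; its gradient is the
  tangential gradient.\<close>

definition bdry_atlas ::
    "('a, real \<times> 'b::euclidean_space) rchart set \<Rightarrow> ('a, 'b) rchart set" where
  "bdry_atlas \<A> = bdry_chart ` \<A>"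

definition C1_fun :: "('a, 'e::euclidean_space) rchart set \<Rightarrow> ('a \<Rightarrow> real) set" where
  "C1_fun \<A> = {f. \<forall>c\<in>\<A>. Ck_on 1 (chart_img c) (f \<circ> chart_inv c)}"

definition chart_deriv ::
    "('a, 'e::euclidean_space) rchart \<Rightarrow> ('a \<Rightarrow> real) \<Rightarrow> 'a \<Rightarrow> 'e \<Rightarrow> real" where
  "chart_deriv c f p =
     frechet_derivative (f \<circ> chart_inv c) (at (chart_map c p) within chart_img c)"

definition chart_grad ::
    "('a, 'e::euclidean_space) rchart \<Rightarrow> ('a \<Rightarrow> real) \<Rightarrow> 'a \<Rightarrow> 'e" where
  "chart_grad c f p = (THE v. \<forall>w. chart_metric c p v w = chart_deriv c f p w)"

definition chart_at :: "('a, 'e) rchart set \<Rightarrow> 'a \<Rightarrow> ('a, 'e) rchart" where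
  "chart_at \<A> p = (SOME c. c \<in> \<A> \<and> p \<in> chart_dom c)"

text \<open>\<open>|\<nabla>f|\<^sup>2\<close> at \<open>p\<close>; the value does not depend on the chart.\<close>

definition grad_sq ::
    "('a, 'e::euclidean_space) rchart set \<Rightarrow> ('a \<Rightarrow> real) \<Rightarrow> 'a \<Rightarrow> real" where
  "grad_sq \<A> f p =
     (let c = chart_at \<A> p; v = chart_grad c f p in chart_metric c p v v)"


section \<open>Volume measure and Hausdorff measure\<close>

text \<open>Determinant of the matrix of a bilinear form in the standard basis (Leibniz formula).\<close>

definition gram_det :: "('e::euclidean_space \<Rightarrow> 'e \<Rightarrow> real) \<Rightarrow> real" where
  "gram_det b = (\<Sum>\<pi> | \<pi> permutes (Basis :: 'e set). of_int (sign \<pi>) * (\<Prod>i\<in>Basis. b i (\<pi> i)))"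

definition is_volume_measure ::
    "'a::t2_space set \<Rightarrow> ('a, 'e::euclidean_space) rchart set \<Rightarrow> 'a measure \<Rightarrow> bool" where
  "is_volume_measure M \<A> \<nu> \<longleftrightarrow>
     sets \<nu> = sets (restrict_space borel M) \<and>
     (\<forall>c\<in>\<A>. \<forall>E\<in>sets \<nu>. E \<subseteq> chart_dom c \<longrightarrow>
        emeasure \<nu> E = (\<integral>\<^sup>+x\<in>chart_map c ` E.
          ennreal (sqrt (gram_det (chart_metric c (chart_inv c x)))) \<partial>lborel))"

text \<open>Riemannian distance. Velocities may vanish, so piecewise \<open>C\<^sup>1\<close> curves can be reparametrized
  to \<open>C\<^sup>1\<close> curves of the same length and need not be considered separately.\<close>

definition C1_curve ::
    "'a::t2_space set \<Rightarrow> ('a, 'e::euclidean_space) rchart set \<Rightarrow> (real \<Rightarrow> 'a) \<Rightarrow> bool" where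
  "C1_curve M \<A> \<gamma> \<longleftrightarrow> continuous_on {0..1} \<gamma> \<and> \<gamma> ` {0..1} \<subseteq> M \<and>
     (\<forall>c\<in>\<A>. Ck_on 1 {t\<in>{0..1}. \<gamma> t \<in> chart_dom c} (chart_map c \<circ> \<gamma>))"

definition curve_speed ::
    "('a, 'e::euclidean_space) rchart set \<Rightarrow> (real \<Rightarrow> 'a) \<Rightarrow> real \<Rightarrow> real" where
  "curve_speed \<A> \<gamma> t =
     (let c = chart_at \<A> (\<gamma> t);
          v = vector_derivative (chart_map c \<circ> \<gamma>) (at t within {0..1})
      in sqrt (chart_metric c (\<gamma> t) v v))"

definition riemannian_dist ::
    "'a::t2_space set \<Rightarrow> ('a, 'e::euclidean_space) rchart set \<Rightarrow> 'a \<Rightarrow> 'a \<Rightarrow> real" where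
  "riemannian_dist M \<A> p q =
     (INF \<gamma>\<in>{\<gamma>. C1_curve M \<A> \<gamma> \<and> \<gamma> 0 = p \<and> \<gamma> 1 = q}. integral {0..1} (curve_speed \<A> \<gamma>))"

definition dist_diam :: "('a \<Rightarrow> 'a \<Rightarrow> real) \<Rightarrow> 'a set \<Rightarrow> ennreal" where
  "dist_diam D E = (SUP x\<in>E. SUP y\<in>E. ennreal (D x y))"

text \<open>\<open>k\<close>-dimensional Hausdorff (outer) measure of \<open>E\<close> in the metric space \<open>(X, D)\<close> for \<open>k \<ge> 1\<close>,
  normalized to agree with Lebesgue measure on \<open>k\<close>-dimensional Euclidean space.\<close>

definition hausdorff_content ::
    "'a set \<Rightarrow> ('a \<Rightarrow> 'a \<Rightarrow> real) \<Rightarrow> nat \<Rightarrow> real \<Rightarrow> 'a set \<Rightarrow> ennreal" where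
  "hausdorff_content X D k \<delta> E =
     (INF C\<in>{C :: nat \<Rightarrow> 'a set. E \<subseteq> (\<Union>i. C i) \<and>
               (\<forall>i. C i \<subseteq> X \<and> dist_diam D (C i) \<le> ennreal \<delta>)}.
        \<Sum>i. ennreal (unit_ball_vol (real k)) * (dist_diam D (C i) / 2) ^ k)"

definition hausdorff_outer ::
    "'a set \<Rightarrow> ('a \<Rightarrow> 'a \<Rightarrow> real) \<Rightarrow> nat \<Rightarrow> 'a set \<Rightarrow> ennreal" where
  "hausdorff_outer X D k E = (SUP \<delta>\<in>{0<..}. hausdorff_content X D k \<delta> E)"

definition surface_measure ::
    "'a::t2_space set \<Rightarrow> ('a, real \<times> 'b::euclidean_space) rchart set \<Rightarrow> 'a measure" where
  "surface_measure M \<A> =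
     measure_of (bdry \<A>) (sets (restrict_space borel (bdry \<A>)))
       (hausdorff_outer M (riemannian_dist M \<A>) DIM('b))"

definition weighted :: "'a measure \<Rightarrow> ('a \<Rightarrow> real) \<Rightarrow> 'a measure" where
  "weighted \<nu> w = density \<nu> (\<lambda>p. ennreal (w p))"

text \<open>The measure \<open>\<alpha> d\<lambda> + \<beta> d\<sigma>\<close> on \<open>M\<close>, where \<open>\<sigma>\<close> lives on a subset of \<open>M\<close>.\<close>

definition sum_measure ::
    "'a::t2_space set \<Rightarrow> ('a \<Rightarrow> real) \<Rightarrow> 'a measure \<Rightarrow> ('a \<Rightarrow> real) \<Rightarrow> 'a measure \<Rightarrow> 'a measure" where
  "sum_measure M \<alpha> lam \<beta> sig =
     measure_of M (sets (restrict_space borel M))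
       (\<lambda>E. (\<integral>\<^sup>+p\<in>E. ennreal (\<alpha> p) \<partial>lam) + (\<integral>\<^sup>+p\<in>E. ennreal (\<beta> p) \<partial>sig))"


section \<open>Variance, entropy and optimal constants\<close>

definition var_of :: "'a measure \<Rightarrow> ('a \<Rightarrow> real) \<Rightarrow> real" where
  "var_of \<nu> f = (\<integral>p. (f p)\<^sup>2 \<partial>\<nu>) - (\<integral>p. f p \<partial>\<nu>)\<^sup>2"

text \<open>\<open>Ent\<^sub>\<nu>(f\<^sup>2)\<close>; the convention \<open>0 ln 0 = 0\<close> holds since \<open>ln 0 = 0\<close> in HOL.\<close>

definition ent_sq :: "'a measure \<Rightarrow> ('a \<Rightarrow> real) \<Rightarrow> real" where
  "ent_sq \<nu> f = (\<integral>p. (f p)\<^sup>2 * ln ((f p)\<^sup>2) \<partial>\<nu>) - (\<integral>p. (f p)\<^sup>2 \<partial>\<nu>) * ln (\<integral>p. (f p)\<^sup>2 \<partial>\<nu>)"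

text \<open>The smallest constant \<open>c\<close> with \<open>F f \<le> c * G f\<close> for all \<open>f \<in> S\<close>, \<open>\<infinity>\<close> if there is none.\<close>

definition smallest_const ::
    "('a \<Rightarrow> real) set \<Rightarrow> (('a \<Rightarrow> real) \<Rightarrow> real) \<Rightarrow> (('a \<Rightarrow> real) \<Rightarrow> real) \<Rightarrow> ereal" where
  "smallest_const S F G = Inf {ereal c | c. 0 \<le> c \<and> (\<forall>f\<in>S. F f \<le> c * G f)}"

definition poincare_const ::
    "'a measure \<Rightarrow> ('a, 'e::euclidean_space) rchart set \<Rightarrow> ereal" where
  "poincare_const \<nu> \<A> =
     smallest_const (C1_fun \<A>) (var_of \<nu>) (\<lambda>f. \<integral>p. grad_sq \<A> f p \<partial>\<nu>)"

definition log_sobolev_const ::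
    "'a measure \<Rightarrow> ('a, 'e::euclidean_space) rchart set \<Rightarrow> ereal" where
  "log_sobolev_const \<nu> \<A> =
     smallest_const (C1_fun \<A>) (ent_sq \<nu>) (\<lambda>f. \<integral>p. grad_sq \<A> f p \<partial>\<nu>)"


section \<open>Weighted Sobolev spaces, embeddings and traces\<close>

text \<open>\<open>W\<^sup>1\<^sup>,\<^sup>2(\<nu>)\<close> is the closure of the \<open>C\<^sup>1\<close> functions in \<open>L\<^sup>2(\<nu>)\<close> with respect to the norm
  \<open>(\<integral> f\<^sup>2 d\<nu> + \<integral> |\<nabla>f|\<^sup>2 d\<nu>)\<^sup>1\<^sup>/\<^sup>2\<close>. Its elements are represented by functions.\<close>

definition sobolev_approx ::
    "'a measure \<Rightarrow> ('a, 'e::euclidean_space) rchart set \<Rightarrow> (nat \<Rightarrow> 'a \<Rightarrow> real) \<Rightarrow> ('a \<Rightarrow> real) \<Rightarrow> bool"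
  where
  "sobolev_approx \<nu> \<A> f u \<longleftrightarrow>
     (\<forall>n. f n \<in> C1_fun \<A>) \<and>
     ((\<lambda>n. \<integral>\<^sup>+p. ennreal ((f n p - u p)\<^sup>2) \<partial>\<nu>) \<longlonglongrightarrow> 0) \<and>
     (\<forall>\<epsilon>>0. \<exists>N. \<forall>m\<ge>N. \<forall>n\<ge>N.
        (\<integral>\<^sup>+p. ennreal (grad_sq \<A> (\<lambda>q. f m q - f n q) p) \<partial>\<nu>) < ennreal \<epsilon>)"

definition W12 :: "'a measure \<Rightarrow> ('a, 'e::euclidean_space) rchart set \<Rightarrow> ('a \<Rightarrow> real) set" where
  "W12 \<nu> \<A> = {u \<in> borel_measurable \<nu>. \<exists>f. sobolev_approx \<nu> \<A> f u}"

definition C1_norm :: "'a measure \<Rightarrow> ('a, 'e::euclidean_space) rchart set \<Rightarrow> ('a \<Rightarrow> real) \<Rightarrow> real" where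
  "C1_norm \<nu> \<A> f = sqrt ((\<integral>p. (f p)\<^sup>2 \<partial>\<nu>) + (\<integral>p. grad_sq \<A> f p \<partial>\<nu>))"

text \<open>Norm of the closure. When the gradient is closable on \<open>L\<^sup>2(\<nu>)\<close> (as it is for weights with
  square root in \<open>W\<^sup>1\<^sup>,\<^sup>2\<close>), the set below is a singleton.\<close>

definition W12_norm :: "'a measure \<Rightarrow> ('a, 'e::euclidean_space) rchart set \<Rightarrow> ('a \<Rightarrow> real) \<Rightarrow> real" where
  "W12_norm \<nu> \<A> u =
     Inf {r. \<exists>f. sobolev_approx \<nu> \<A> f u \<and> (\<lambda>n. C1_norm \<nu> \<A> (f n)) \<longlonglongrightarrow> r}"

definition L2_fun :: "'a measure \<Rightarrow> ('a \<Rightarrow> real) set" where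
  "L2_fun \<nu> = {u \<in> borel_measurable \<nu>. integrable \<nu> (\<lambda>p. (u p)\<^sup>2)}"

definition compact_W12_L2 ::
    "'a measure \<Rightarrow> ('a, 'e::euclidean_space) rchart set \<Rightarrow> 'a measure \<Rightarrow>
     (('a \<Rightarrow> real) \<Rightarrow> ('a \<Rightarrow> real)) \<Rightarrow> bool" where
  "compact_W12_L2 \<nu> \<A> \<nu>' T \<longleftrightarrow>
     (\<forall>u\<in>W12 \<nu> \<A>. T u \<in> L2_fun \<nu>') \<and>
     (\<forall>u\<in>W12 \<nu> \<A>. \<forall>v\<in>W12 \<nu> \<A>. \<forall>a b.
        AE p in \<nu>'. T (\<lambda>q. a * u q + b * v q) p = a * T u p + b * T v p) \<and>
     (\<forall>u R. (\<forall>n. u n \<in> W12 \<nu> \<A> \<and> W12_norm \<nu> \<A> (u n) \<le> R) \<longrightarrow>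
        (\<exists>(r :: nat \<Rightarrow> nat) v. strict_mono r \<and> v \<in> L2_fun \<nu>' \<and>
           (\<lambda>n. \<integral>p. (T (u (r n)) p - v p)\<^sup>2 \<partial>\<nu>') \<longlonglongrightarrow> 0))"

definition compact_embedding :: "'a measure \<Rightarrow> ('a, 'e::euclidean_space) rchart set \<Rightarrow> bool" where
  "compact_embedding \<nu> \<A> \<longleftrightarrow> compact_W12_L2 \<nu> \<A> \<nu> (\<lambda>u. u)"

text \<open>The trace operator is the extension of the restriction of \<open>C\<^sup>1\<close> functions to the space
  of \<open>\<nu>'\<close>.\<close>

definition compact_trace ::
    "'a measure \<Rightarrow> ('a, 'e::euclidean_space) rchart set \<Rightarrow> 'a measure \<Rightarrow> bool" where
  "compact_trace \<nu> \<A> \<nu>' \<longleftrightarrow>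
     (\<exists>T. (\<forall>f\<in>C1_fun \<A>. AE p in \<nu>'. T f p = f p) \<and> compact_W12_L2 \<nu> \<A> \<nu>' T)"

definition continuous_embedding_Lp ::
    "'a measure \<Rightarrow> ('a, 'e::euclidean_space) rchart set \<Rightarrow> real \<Rightarrow> 'a measure \<Rightarrow> bool" where
  "continuous_embedding_Lp \<nu> \<A> s \<nu>' \<longleftrightarrow>
     (\<exists>K. \<forall>u\<in>W12 \<nu> \<A>. u \<in> borel_measurable \<nu>' \<and> integrable \<nu>' (\<lambda>p. \<bar>u p\<bar> powr s) \<and>
        (\<integral>p. \<bar>u p\<bar> powr s \<partial>\<nu>') powr (1 / s) \<le> K * W12_norm \<nu> \<A> u)"

end

theory Submission imports Defs begin

text \<open>
  The measure \<open>\<mu>\<close> is the mixture \<open>A \<lambda>\<^sub>\<alpha> + B \<sigma>\<^sub>\<beta>\<close> of two probability measures, so with the means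
  \<open>a = \<integral> f d\<lambda>\<^sub>\<alpha>\<close> and \<open>b = \<integral> f d\<sigma>\<^sub>\<beta>\<close> one has
  \<open>Var\<^sub>\<mu>(f) = A Var(f; \<lambda>\<^sub>\<alpha>) + B Var(f; \<sigma>\<^sub>\<beta>) + A B (b - a)\<^sup>2\<close> (\<open>weighted_variance_identity\<close>).
  The two variances are controlled by the Poincare inequalities in the interior and on the boundary.
  Neither of these sees the difference of the means; the link between interior and boundary is the
  trace. Since the trace operator is compact, it is bounded (\<open>compact_trace_bounded\<close>). Applied to
  \<open>h = f - a\<close>, the bound gives
  \<open>B (b - a)\<^sup>2 \<le> \<integral> h\<^sup>2 \<beta> d\<sigma> \<le> K (\<integral> h\<^sup>2 \<alpha> d\<lambda> + \<integral> |\<nabla>f|\<^sup>2 \<alpha> d\<lambda>) \<le> K (c + 1) \<integral> |\<nabla>f|\<^sup>2 \<alpha> d\<lambda>\<close>.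
  The last step is the interior Poincare inequality with constant \<open>c\<close>, because \<open>h\<close> has interior mean
  zero and the same gradient as \<open>f\<close>.

  Boundedness of the trace is obtained by rescaling a sequence of counterexamples, which requires
  \<open>|\<nabla>(t f)|\<^sup>2 = t\<^sup>2 |\<nabla>f|\<^sup>2\<close> (\<open>grad_sq_scale\<close>). This rests on two facts about charts in the
  half-space: derivatives are unique up to the boundary (\<open>half_space_derivative_unique\<close>), and the
  metric represents every linear form by a vector (\<open>inner_product_represents_linear\<close>).

  The statement is about Bochner integrals, which vanish on functions that are not integrable. The
  argument treats the Dirichlet energies as functionals that are nonnegative, homogeneous and
  invariant under shifts by constants, and these properties are compatible with the convention.
\<close>

section \<open>Gradients of \<open>C\<^sup>1\<close> functions on a manifold with boundary\<close>

text \<open>At a boundary point of the half-space only one of the two directions along the normal axis is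
  available, but a single sequence of admissible steps along each axis already determines the
  derivative. Without uniqueness the gradient, whose definition picks some derivative, could not be
  computed.\<close>

lemma half_space_derivative_unique:
  fixes S :: "(real \<times> 'b::euclidean_space) set" and f :: "_ \<Rightarrow> 'c::real_normed_vector"
  assumes S: "openin (top_of_set half_space) S" and x: "x \<in> S"
    and D: "(f has_derivative D) (at x within S)" "(f has_derivative D') (at x within S)"
  shows "D = D'"
proof (rule frechet_derivative_unique_within[OF D])
  fix i :: "real \<times> 'b" and e :: real
  assume i: "i \<in> Basis" and e: "0 < e"
  obtain r where r: "r > 0" "ball x r \<inter> half_space \<subseteq> S"
    using S x unfolding openin_contains_ball by blast
  define t where "t = min e r / 2"
  have t: "0 < t" "t < e" "t < r" using e r by (auto simp: t_def min_def)
  have "x \<in> half_space" using S x openin_imp_subset by blast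
  moreover have "0 \<le> fst i" using i by (auto simp: Basis_prod_def)
  ultimately have "x + t *\<^sub>R i \<in> half_space"
    using t by (simp add: half_space_def)
  moreover have "x + t *\<^sub>R i \<in> ball x r"
    using t i by (simp add: dist_norm)
  ultimately show "\<exists>d. 0 < \<bar>d\<bar> \<and> \<bar>d\<bar> < e \<and> x + d *\<^sub>R i \<in> S"
    using t r by (intro exI[of _ t]) auto
qed

text \<open>Finite-dimensional Riesz representation: \<open>v \<mapsto> b v\<close> is injective by definiteness, hence onto the
  dual space, which is identified with the space itself through the coordinates \<open>L\<close>. It shows
  that the definite description in \<^const>\<open>chart_grad\<close> denotes the gradient.\<close>

lemma inner_product_represents_linear:
  fixes b :: "'e::euclidean_space \<Rightarrow> 'e \<Rightarrow> real"
  assumes b: "bilinear b" and pos: "\<And>v. v \<noteq> 0 \<Longrightarrow> 0 < b v v" and D: "linear D"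
  shows "\<exists>!v. \<forall>w. b v w = D w"
proof -
  define L where "L v = (\<Sum>i\<in>Basis. b v i *\<^sub>R i)" for v
  have lin1: "linear (\<lambda>v. b v w)" and lin2: "linear (b v)" for v w
    using b by (auto simp: bilinear_def)
  have "linear L"
    unfolding L_def
    by (intro linear_compose_sum ballI linear_compose[OF lin1, unfolded o_def] linear_scaleR_left)
  have eq: "b v w = D w" if L: "L v = (\<Sum>i\<in>Basis. D i *\<^sub>R i)" and D: "linear D" for v D w
  proof -
    have "b v i = D i" if "i \<in> Basis" for i
      using arg_cong[OF L, of "\<lambda>z. z \<bullet> i"] that
      by (simp add: L_def inner_sum_left inner_Basis if_distrib cong: if_cong)
    then show ?thesis using linear_eq_stdbasis[OF lin2 D] by metis
  qed
  have zero: "v = 0" if "\<forall>w. b v w = 0" for v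
    using pos[of v] that by force
  have "inj L"
    using zero eq[of _ "\<lambda>_. 0"] \<open>linear L\<close>
    by (auto simp: linear_injective_0 linear_zero)
  then obtain v where "L v = (\<Sum>i\<in>Basis. D i *\<^sub>R i)"
    using linear_injective_imp_surjective[OF \<open>linear L\<close>] by (metis surjD)
  then have "\<forall>w. b v w = D w" using eq D by blast
  moreover have "u = v" if "\<forall>w. b u w = D w" for u
    using zero[of "u - v"] that \<open>\<forall>w. b v w = D w\<close> linear_diff[OF lin1] by auto
  ultimately show ?thesis by blast
qed

lemma C1_funD:
  assumes "f \<in> C1_fun \<A>" "c \<in> \<A>"
  obtains f' where "\<And>x. x \<in> chart_img c \<Longrightarrow>
      ((f \<circ> chart_inv c) has_derivative f' x) (at x within chart_img c)"
    and "\<And>v. continuous_on (chart_img c) (\<lambda>x. f' x v)"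
proof -
  have "\<exists>f'. (\<forall>x\<in>chart_img c. ((f \<circ> chart_inv c) has_derivative f' x) (at x within chart_img c)) \<and>
      (\<forall>v. continuous_on (chart_img c) (\<lambda>x. f' x v))"
    using assms by (simp add: C1_fun_def)
  then show thesis using that by blast
qed

lemma C1_fun_scale:
  assumes "f \<in> C1_fun \<A>"
  shows "(\<lambda>p. t * f p) \<in> C1_fun \<A>"
proof -
  have "Ck_on 1 (chart_img c) ((\<lambda>p. t * f p) \<circ> chart_inv c)" if "c \<in> \<A>" for c
  proof (rule C1_funD[OF assms that])
    fix f'
    assume "\<And>x. x \<in> chart_img c \<Longrightarrow>
        ((f \<circ> chart_inv c) has_derivative f' x) (at x within chart_img c)"
      and "\<And>v. continuous_on (chart_img c) (\<lambda>x. f' x v)"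
    then show ?thesis
      by (auto simp: o_def intro!: exI[of _ "\<lambda>x v. t * f' x v"] has_derivative_mult_right
          continuous_on_mult_left)
  qed
  then show ?thesis by (simp add: C1_fun_def)
qed

lemma C1_fun_diff_const:
  assumes "f \<in> C1_fun \<A>"
  shows "(\<lambda>p. f p - a) \<in> C1_fun \<A>"
proof -
  have "Ck_on 1 (chart_img c) ((\<lambda>p. f p - a) \<circ> chart_inv c)" if "c \<in> \<A>" for c
  proof (rule C1_funD[OF assms that])
    fix f'
    assume "\<And>x. x \<in> chart_img c \<Longrightarrow>
        ((f \<circ> chart_inv c) has_derivative f' x) (at x within chart_img c)"
      and "\<And>v. continuous_on (chart_img c) (\<lambda>x. f' x v)"
    then show ?thesis
      by (auto simp: o_def intro!: exI[of _ f'] has_derivative_diff[where g'="\<lambda>_. 0", simplified])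
  qed
  then show ?thesis by (simp add: C1_fun_def)
qed

lemma chart_at_mem:
  assumes "p \<in> (\<Union>c\<in>\<A>. chart_dom c)"
  shows "chart_at \<A> p \<in> \<A>" "p \<in> chart_dom (chart_at \<A> p)"
  using assms someI_ex[of "\<lambda>c. c \<in> \<A> \<and> p \<in> chart_dom c"] by (auto simp: chart_at_def)

lemma grad_sq_nonneg:
  assumes "riemannian_atlas H M \<A>" "p \<in> M"
  shows "0 \<le> grad_sq \<A> f p"
proof -
  have c: "chart_at \<A> p \<in> \<A>" "p \<in> chart_dom (chart_at \<A> p)"
    using chart_at_mem[of p \<A>] assms by (auto simp: riemannian_atlas_def)
  then have "bilinear (chart_metric (chart_at \<A> p) p)"
    and "\<And>v. v \<noteq> 0 \<Longrightarrow> 0 < chart_metric (chart_at \<A> p) p v v"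
    using assms(1) by (auto simp: riemannian_atlas_def)
  then show ?thesis
    unfolding grad_sq_def Let_def by (metis bilinear_lzero order_less_imp_le order_refl)
qed

lemma grad_sq_bdry_nonneg:
  assumes "riemannian_atlas H M \<A>" "p \<in> bdry \<A>"
  shows "0 \<le> grad_sq (bdry_atlas \<A>) f p"
proof -
  have "p \<in> (\<Union>c\<in>bdry_atlas \<A>. chart_dom c)"
    using assms(2) by (auto simp: bdry_def bdry_atlas_def bdry_chart_def)
  from chart_at_mem[OF this] obtain c where c: "c \<in> \<A>" "chart_at (bdry_atlas \<A>) p = bdry_chart c"
    "p \<in> chart_dom c"
    by (auto simp: bdry_atlas_def bdry_chart_def)
  then have "bilinear (chart_metric c p)" and "\<And>v. v \<noteq> 0 \<Longrightarrow> 0 < chart_metric c p v v"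
    using assms(1) by (auto simp: riemannian_atlas_def)
  then have "0 \<le> chart_metric c p v v" for v
    by (metis bilinear_lzero order_less_imp_le order_refl)
  then show ?thesis
    unfolding grad_sq_def Let_def c by (simp add: bdry_chart_def)
qed

text \<open>A function and its shift have exactly the same derivatives at every point, so the arbitrary
  choice made by \<^const>\<open>frechet_derivative\<close> agrees for both; hence the identity holds for all
  functions and at all points.\<close>

lemma grad_sq_diff_const: "grad_sq \<A> (\<lambda>p. f p - a) = grad_sq \<A> f"
proof -
  have "((\<lambda>p. f p - a) \<circ> g has_derivative D) F = (f \<circ> g has_derivative D) F"
    for g :: "'b \<Rightarrow> 'a" and D F
    using has_derivative_add_const[of "\<lambda>x. f (g x) - a" D F a]
      has_derivative_diff[of "\<lambda>x. f (g x)" D F "\<lambda>_. a" "\<lambda>_. 0"]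
    by (auto simp: o_def)
  then have "chart_deriv c (\<lambda>p. f p - a) p = chart_deriv c f p" for c :: "('a, 'b) rchart" and p
    by (simp add: chart_deriv_def frechet_derivative_def)
  then show ?thesis
    by (simp add: fun_eq_iff grad_sq_def chart_grad_def)
qed

text \<open>Homogeneity needs the true gradient: a derivative chosen for \<open>t f\<close> is \<open>t\<close> times the one chosen
  for \<open>f\<close> only because derivatives on charts are unique, and the gradients correspond only because
  the representing vectors exist.\<close>

lemma grad_sq_scale:
  assumes atl: "riemannian_atlas half_space M \<A>" and p: "p \<in> M" and f: "f \<in> C1_fun \<A>"
  shows "grad_sq \<A> (\<lambda>q. t * f q) p = t\<^sup>2 * grad_sq \<A> f p"
proof -
  define c where "c = chart_at \<A> p"
  have c: "c \<in> \<A>" "p \<in> chart_dom c"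
    using chart_at_mem[of p \<A>] atl p by (auto simp: c_def riemannian_atlas_def)
  let ?b = "chart_metric c p" and ?S = "chart_img c" and ?x = "chart_map c p"
  have b: "bilinear ?b" "\<And>v. v \<noteq> 0 \<Longrightarrow> 0 < ?b v v" and S: "openin (top_of_set half_space) ?S"
    using atl c by (auto simp: riemannian_atlas_def)
  have x: "?x \<in> ?S" using c by (auto simp: chart_img_def)
  obtain D where D: "((f \<circ> chart_inv c) has_derivative D) (at ?x within ?S)"
    using C1_funD[OF f c(1)] x by metis
  have tD: "(((\<lambda>q. t * f q) \<circ> chart_inv c) has_derivative (\<lambda>w. t * D w)) (at ?x within ?S)"
    using has_derivative_mult_right[OF D, of t] by (simp add: o_def)
  have deriv: "chart_deriv c h p = D'"
    if "((h \<circ> chart_inv c) has_derivative D') (at ?x within ?S)" for h D'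
    using half_space_derivative_unique[OF S x] that
    by (metis chart_deriv_def differentiableI frechet_derivative_works)
  have linD: "linear D" using D by (rule has_derivative_linear)
  have lintD: "linear (\<lambda>w. t * D w)" using tD by (rule has_derivative_linear)
  define v where "v = chart_grad c f p"
  have v: "\<forall>w. ?b v w = D w"
    unfolding v_def chart_grad_def deriv[OF D]
    by (rule theI'[OF inner_product_represents_linear[OF b linD]])
  have "chart_grad c (\<lambda>q. t * f q) p = t *\<^sub>R v"
    unfolding chart_grad_def deriv[OF tD]
    using inner_product_represents_linear[OF b lintD] v
    by (intro the1_equality) (auto simp: bilinear_lmul[OF b(1)])
  then show ?thesis
    by (simp add: grad_sq_def Let_def flip: c_def v_def)
      (simp add: bilinear_lmul[OF b(1)] bilinear_rmul[OF b(1)] power2_eq_square)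
qed

text \<open>The chart domains form an open cover of the manifold, and continuity is local.\<close>

lemma C1_fun_continuous_on:
  assumes atl: "riemannian_atlas H M \<A>" and f: "f \<in> C1_fun \<A>"
  shows "continuous_on M f"
proof -
  have cover: "(\<Union>c\<in>\<A>. chart_dom c) = M" and ope: "\<And>c. c \<in> \<A> \<Longrightarrow> openin (top_of_set M) (chart_dom c)"
    and hom: "\<And>c. c \<in> \<A> \<Longrightarrow> homeomorphism (chart_dom c) (chart_img c) (chart_map c) (chart_inv c)"
    using atl by (auto simp: riemannian_atlas_def)
  have loc: "continuous_on (chart_dom c) f" if c: "c \<in> \<A>" for c
  proof -
    have "continuous_on (chart_img c) (f \<circ> chart_inv c)"
      using C1_funD[OF f c] has_derivative_continuous
      by (metis continuous_on_eq_continuous_within)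
    then have "continuous_on (chart_dom c) ((f \<circ> chart_inv c) \<circ> chart_map c)"
      using hom[OF c] by (intro continuous_on_compose[of _ "chart_map c"]) (auto simp: homeomorphism_def)
    moreover have "((f \<circ> chart_inv c) \<circ> chart_map c) p = f p" if "p \<in> chart_dom c" for p
      using hom[OF c] that by (simp add: homeomorphism_def)
    ultimately show ?thesis
      by (simp cong: continuous_on_cong)
  qed
  have "continuous_map (top_of_set M) euclidean f"
  proof (rule pasting_lemma[where I=\<A> and T=chart_dom and f="\<lambda>_. f"])
    fix c assume "c \<in> \<A>"
    then have "M \<inter> chart_dom c = chart_dom c" using cover by auto
    then show "continuous_map (subtopology (top_of_set M) (chart_dom c)) euclidean f"
      using loc[OF \<open>c \<in> \<A>\<close>] by (simp add: subtopology_subtopology)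
  qed (use ope cover in auto)
  then show ?thesis by simp
qed

lemma bdry_subset:
  assumes "riemannian_atlas H M \<A>"
  shows "bdry \<A> \<subseteq> M"
  using assms by (auto simp: bdry_def riemannian_atlas_def)

text \<open>In a boundary chart the restriction of \<open>f\<close> is the composition of its expression in the ambient
  chart with the inclusion \<open>x \<mapsto> (0, x)\<close> of the boundary slice, so the chain rule applies.\<close>

lemma C1_fun_bdry:
  assumes f: "f \<in> C1_fun \<A>"
    and atl: "riemannian_atlas H M \<A>"
  shows "f \<in> C1_fun (bdry_atlas \<A>)"
proof -
  have "Ck_on 1 (chart_img (bdry_chart c)) (f \<circ> chart_inv (bdry_chart c))" if c: "c \<in> \<A>" for c
  proof -
    let ?S = "chart_img (bdry_chart c)"
    have hom: "homeomorphism (chart_dom c) (chart_img c) (chart_map c) (chart_inv c)"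
      using atl c by (auto simp: riemannian_atlas_def)
    obtain f' where f': "\<And>x. x \<in> chart_img c \<Longrightarrow>
        ((f \<circ> chart_inv c) has_derivative f' x) (at x within chart_img c)"
      and cont: "\<And>v. continuous_on (chart_img c) (\<lambda>x. f' x v)"
      using C1_funD[OF f c] by metis
    have slice: "(0, x) \<in> chart_img c" if x: "x \<in> ?S" for x
    proof -
      obtain p where "p \<in> chart_dom c" "fst (chart_map c p) = 0" "x = snd (chart_map c p)"
        using x unfolding chart_img_def bdry_chart_def by force
      then show ?thesis unfolding chart_img_def by (intro image_eqI[of _ _ p]) (auto simp: prod_eq_iff)
    qed
    have inv: "chart_inv (bdry_chart c) x = chart_inv c (0, x)" if x: "x \<in> ?S" for x
    proof -
      have "inj_on (chart_map c) (chart_dom c)"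
        using hom by (meson homeomorphism_apply1 inj_on_inverseI)
      then have "inj_on (snd \<circ> chart_map c) {p \<in> chart_dom c. fst (chart_map c p) = 0}"
        by (auto simp: inj_on_def prod_eq_iff)
      moreover have "chart_inv c (0, x) \<in> chart_dom c" "chart_map c (chart_inv c (0, x)) = (0, x)"
        using hom slice[OF x] by (auto simp: homeomorphism_def)
      ultimately show ?thesis
        unfolding chart_inv_def[of "bdry_chart c"]
        by (intro inv_into_f_eq) (auto simp: bdry_chart_def)
    qed
    have der: "((f \<circ> chart_inv (bdry_chart c)) has_derivative (\<lambda>v. f' (0, x) (0, v))) (at x within ?S)"
      if x: "x \<in> ?S" for x
    proof -
      have "((\<lambda>y. (0::real, y)) has_derivative (\<lambda>v. (0, v))) (at x within ?S)"
        by (auto intro!: derivative_eq_intros)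
      moreover have "((f \<circ> chart_inv c) has_derivative f' (0, x)) (at (0, x) within (\<lambda>y. (0, y)) ` ?S)"
        using f'[OF slice[OF x]] slice by (auto intro: has_derivative_subset)
      ultimately have "((f \<circ> chart_inv c) \<circ> (\<lambda>y. (0, y)) has_derivative f' (0, x) \<circ> (\<lambda>v. (0, v))) (at x within ?S)"
        by (rule diff_chain_within)
      then show ?thesis
        unfolding o_def
        by (rule has_derivative_transform[OF x, rotated]) (simp add: inv)
    qed
    have "continuous_on ?S (\<lambda>x. f' (0, x) (0, v))" for v
      using slice by (intro continuous_on_compose2[OF cont[of "(0, v)"]] continuous_intros) auto
    then show ?thesis
      using der by (auto intro!: exI[of _ "\<lambda>x v. f' (0, x) (0, v)"])
  qed
  then show ?thesis by (auto simp: C1_fun_def bdry_atlas_def)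
qed


section \<open>Variances and normalized weights\<close>

text \<open>For weights \<open>A\<close>, \<open>B\<close> of two probability measures with means \<open>a\<close>, \<open>b\<close> and second moments
  \<open>x\<close>, \<open>y\<close>, the left side is the variance of the mixture.\<close>

lemma weighted_variance_identity:
  fixes A B a b x y :: real
  assumes "A + B = 1"
  shows "A * x + B * y - (A * a + B * b)\<^sup>2 = A * (x - a\<^sup>2) + B * (y - b\<^sup>2) + A * (B * (b - a)\<^sup>2)"
proof -
  have B: "B = 1 - A" using assms by simp
  show ?thesis unfolding B by (simp add: power2_eq_square algebra_simps)
qed

lemma prob_space_second_moment_about:
  assumes "prob_space \<nu>" and f: "integrable \<nu> f" "integrable \<nu> (\<lambda>p. (f p)\<^sup>2)"
  shows "(\<integral>p. (f p - a)\<^sup>2 \<partial>\<nu>) = var_of \<nu> f + ((\<integral>p. f p \<partial>\<nu>) - a)\<^sup>2"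
proof -
  interpret prob_space \<nu> by fact
  have "(\<integral>p. (f p - a)\<^sup>2 \<partial>\<nu>) = (\<integral>p. (f p)\<^sup>2 - 2 * a * f p + a\<^sup>2 \<partial>\<nu>)"
    by (simp add: power2_diff algebra_simps)
  also have "\<dots> = (\<integral>p. (f p)\<^sup>2 \<partial>\<nu>) - 2 * a * (\<integral>p. f p \<partial>\<nu>) + a\<^sup>2"
    using f by (simp add: prob_space)
  finally show ?thesis by (simp add: var_of_def power2_diff)
qed

lemma prob_space_var_of_nonneg:
  assumes "prob_space \<nu>" and f: "integrable \<nu> f" "integrable \<nu> (\<lambda>p. (f p)\<^sup>2)"
  shows "0 \<le> var_of \<nu> f"
  using prob_space_second_moment_about[OF assms, of "\<integral>p. f p \<partial>\<nu>"]
    Bochner_Integration.integral_nonneg[of \<nu> "\<lambda>p. (f p - (\<integral>p. f p \<partial>\<nu>))\<^sup>2"] by simp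

text \<open>For a non-measurable \<open>h\<close> both sides vanish by the convention for the Bochner integral. The
  case is included so that the identity applies directly to \<open>h = |\<nabla>f|\<^sup>2\<close>, which is defined through
  arbitrary choices of charts.\<close>

lemma integral_weighted_divide:
  fixes h :: "'a \<Rightarrow> real"
  assumes w: "w \<in> borel_measurable \<nu>" "AE p in \<nu>. 0 \<le> w p" and c: "0 < c"
  shows "(\<integral>p. h p \<partial>weighted \<nu> (\<lambda>p. w p / c)) = (\<integral>p. h p \<partial>weighted \<nu> w) / c"
proof (cases "h \<in> borel_measurable \<nu>")
  case True
  have "AE p in \<nu>. 0 \<le> w p / c" using w(2) c by auto
  then show ?thesis
    using True w c by (simp add: weighted_def integral_density flip: integral_divide_zero)
next
  case False
  then have "\<not> integrable (weighted \<nu> (\<lambda>p. w p / c)) h" "\<not> integrable (weighted \<nu> w) h"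
    by (auto simp: weighted_def dest: borel_measurable_integrable)
  then show ?thesis by (simp add: not_integrable_integral_eq)
qed

lemma emeasure_weighted_space:
  assumes w: "integrable \<nu> w" "AE p in \<nu>. 0 \<le> w p"
  shows "emeasure (weighted \<nu> w) (space \<nu>) = ennreal (\<integral>p. w p \<partial>\<nu>)"
proof -
  have "emeasure (weighted \<nu> w) (space \<nu>) = (\<integral>\<^sup>+p. ennreal (w p) * indicator (space \<nu>) p \<partial>\<nu>)"
    using w(1) by (simp add: weighted_def emeasure_density)
  also have "\<dots> = (\<integral>\<^sup>+p. ennreal (w p) \<partial>\<nu>)"
    by (intro nn_integral_cong) simp
  finally show ?thesis using w by (simp add: nn_integral_eq_integral)
qed

lemma prob_space_weighted_divide:
  assumes w: "integrable \<nu> w" "AE p in \<nu>. 0 \<le> w p" and c: "c = (\<integral>p. w p \<partial>\<nu>)" "0 < c"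
  shows "prob_space (weighted \<nu> (\<lambda>p. w p / c))"
proof
  have "AE p in \<nu>. 0 \<le> w p / c" using w(2) c by auto
  then have "emeasure (weighted \<nu> (\<lambda>p. w p / c)) (space \<nu>) = ennreal (\<integral>p. w p / c \<partial>\<nu>)"
    using w by (intro emeasure_weighted_space) auto
  then show "emeasure (weighted \<nu> (\<lambda>p. w p / c)) (space (weighted \<nu> (\<lambda>p. w p / c))) = 1"
    using c by (simp add: weighted_def)
qed

section \<open>Integration against the sum of interior and boundary measure\<close>

text \<open>\<^const>\<open>sum_measure\<close> is the null measure unless its set function is a measure, so nondegeneracy
  gives the expected values on measurable sets. The identity extends from indicators to
  nonnegative functions by linearity and monotone convergence.\<close>

lemma nn_integral_sum_measure:
  fixes M :: "'a::t2_space set"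
  assumes lam: "sets lam = sets (restrict_space borel M)"
    and sig: "sets sig = sets (restrict_space borel T)" and "T \<subseteq> M"
    and \<alpha>: "\<alpha> \<in> borel_measurable lam" and \<beta>: "\<beta> \<in> borel_measurable sig"
    and nz: "emeasure (sum_measure M \<alpha> lam \<beta> sig) M \<noteq> 0"
    and g: "g \<in> borel_measurable (restrict_space borel M)"
  shows "(\<integral>\<^sup>+p. g p \<partial>sum_measure M \<alpha> lam \<beta> sig) =
    (\<integral>\<^sup>+p. g p \<partial>weighted lam \<alpha>) + (\<integral>\<^sup>+p. g p \<partial>weighted sig \<beta>)"
proof -
  let ?R = "restrict_space borel M" and ?mu = "sum_measure M \<alpha> lam \<beta> sig"
  let ?\<mu> = "\<lambda>E. (\<integral>\<^sup>+p\<in>E. ennreal (\<alpha> p) \<partial>lam) + (\<integral>\<^sup>+p\<in>E. ennreal (\<beta> p) \<partial>sig)"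
  have sub: "sets ?R \<subseteq> Pow M" and sigma: "sigma_sets M (sets ?R) = sets ?R"
    using sets.space_closed[of ?R] sets.sigma_sets_eq[of ?R] by (auto simp: space_restrict_space)
  have sets_mu: "sets ?mu = sets ?R"
    using sub sigma by (simp add: sum_measure_def)
  have em_eq: "emeasure ?mu = (\<lambda>E. if E \<in> sets ?R \<and> measure_space M (sets ?R) ?\<mu> then ?\<mu> E else 0)"
    unfolding sum_measure_def emeasure_measure_of_conv sigma ..
  have "measure_space M (sets ?R) ?\<mu>"
    by (rule ccontr) (use nz em_eq in simp)
  then have em: "emeasure ?mu E = ?\<mu> E" if "E \<in> sets ?R" for E
    using that em_eq by simp
  have m_lam: "h \<in> borel_measurable lam" if "h \<in> borel_measurable ?R" for h :: "'a \<Rightarrow> ennreal"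
    using that measurable_cong_sets[OF lam] by blast
  have m_sig: "h \<in> borel_measurable sig" if "h \<in> borel_measurable ?R" for h :: "'a \<Rightarrow> ennreal"
    using measurable_restrict_mono[OF that \<open>T \<subseteq> M\<close>] measurable_cong_sets[OF sig] by blast
  have m_mu: "h \<in> borel_measurable ?mu" if "h \<in> borel_measurable ?R" for h :: "'a \<Rightarrow> ennreal"
    using that measurable_cong_sets[OF sets_mu] by blast
  have spaces: "space lam = M" "space sig = T" "space ?mu = M"
    using sets_eq_imp_space_eq[OF lam] sets_eq_imp_space_eq[OF sig] sets_eq_imp_space_eq[OF sets_mu]
    by (auto simp: space_restrict_space)
  have dens: "(\<integral>\<^sup>+p. h p \<partial>weighted lam \<alpha>) = (\<integral>\<^sup>+p. \<alpha> p * h p \<partial>lam)"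
    "(\<integral>\<^sup>+p. h p \<partial>weighted sig \<beta>) = (\<integral>\<^sup>+p. \<beta> p * h p \<partial>sig)"
    if "h \<in> borel_measurable ?R" for h :: "'a \<Rightarrow> ennreal"
    using \<alpha> \<beta> m_lam[OF that] m_sig[OF that] by (simp_all add: weighted_def nn_integral_density)
  have m_w: "h \<in> borel_measurable (weighted lam \<alpha>)" "h \<in> borel_measurable (weighted sig \<beta>)"
    if "h \<in> borel_measurable ?R" for h :: "'a \<Rightarrow> ennreal"
    using m_lam[OF that] m_sig[OF that] by (simp_all add: weighted_def)
  show ?thesis
    using g
  proof (induction rule: borel_measurable_induct)
    case (cong f g)
    have "(\<integral>\<^sup>+p. f p \<partial>\<nu>) = (\<integral>\<^sup>+p. g p \<partial>\<nu>)" if "space \<nu> \<subseteq> M" for \<nu>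
      using cong(3) that by (intro nn_integral_cong) (auto simp: space_restrict_space)
    then show ?case using cong(4) spaces \<open>T \<subseteq> M\<close> by (simp add: weighted_def)
  next
    case (set E)
    then have "(\<integral>\<^sup>+p. indicator E p \<partial>?mu) = ?\<mu> E"
      using em sets_mu by simp
    then show ?case using set dens[of "indicator E"] by simp
  next
    case (mult u c)
    then show ?case
      using m_mu[OF mult(2)] m_w[OF mult(2)] by (simp add: nn_integral_cmult distrib_left)
  next
    case (add u v)
    then show ?case
      using m_mu[OF add(1)] m_w[OF add(1)] m_mu[OF add(3)] m_w[OF add(3)]
      by (simp add: nn_integral_add ac_simps)
  next
    case (seq U)
    have sup: "(\<integral>\<^sup>+p. (SUP i. U i) p \<partial>\<nu>) = (SUP i. \<integral>\<^sup>+p. U i p \<partial>\<nu>)"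
      if "\<And>i. U i \<in> borel_measurable \<nu>" for \<nu>
      using nn_integral_monotone_convergence_SUP[OF seq(3) that] by (simp add: image_comp)
    have inc: "incseq (\<lambda>i. \<integral>\<^sup>+p. U i p \<partial>\<nu>)" for \<nu>
      using seq(3) by (auto simp: incseq_def le_fun_def intro!: nn_integral_mono)
    show ?case
      unfolding sup[OF m_mu[OF seq(1)]] sup[OF m_w(1)[OF seq(1)]] sup[OF m_w(2)[OF seq(1)]] seq(5)
      by (rule ennreal_SUP_add[OF inc inc])
  qed
qed

text \<open>For nonnegative functions this is the identity for \<open>\<integral>\<^sup>+\<close> between finite values; the shift
  \<open>f + K\<close> is nonnegative, and the constant is subtracted afterwards.\<close>

lemma integral_sum_measure:
  fixes M :: "'a::t2_space set" and f :: "'a \<Rightarrow> real"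
  assumes lam: "sets lam = sets (restrict_space borel M)"
    and sig: "sets sig = sets (restrict_space borel T)" and "T \<subseteq> M"
    and \<alpha>: "\<alpha> \<in> borel_measurable lam" and \<beta>: "\<beta> \<in> borel_measurable sig"
    and mu: "prob_space (sum_measure M \<alpha> lam \<beta> sig)"
    and f: "f \<in> borel_measurable (restrict_space borel M)" and bound: "\<And>p. p \<in> M \<Longrightarrow> \<bar>f p\<bar> \<le> K"
    and fin: "finite_measure (weighted lam \<alpha>)" "finite_measure (weighted sig \<beta>)"
  shows "(\<integral>p. f p \<partial>sum_measure M \<alpha> lam \<beta> sig) =
    (\<integral>p. f p \<partial>weighted lam \<alpha>) + (\<integral>p. f p \<partial>weighted sig \<beta>)"
proof -
  let ?R = "restrict_space borel M" and ?mu = "sum_measure M \<alpha> lam \<beta> sig"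
  let ?P = "weighted lam \<alpha>" and ?Q = "weighted sig \<beta>"
  have "sigma_sets M (sets ?R) = sets ?R" "sets ?R \<subseteq> Pow M"
    using sets.space_closed[of ?R] sets.sigma_sets_eq[of ?R] by (auto simp: space_restrict_space)
  then have sets_mu: "sets ?mu = sets ?R" by (simp add: sum_measure_def)
  have spaces: "space ?P = M" "space ?Q = T" "space ?mu = M"
    using sets_eq_imp_space_eq[OF lam] sets_eq_imp_space_eq[OF sig] sets_eq_imp_space_eq[OF sets_mu]
    by (auto simp: space_restrict_space weighted_def)
  interpret mu: prob_space ?mu by fact
  interpret P: finite_measure ?P by fact
  interpret Q: finite_measure ?Q by fact
  have nz: "emeasure ?mu M \<noteq> 0" using mu.emeasure_space_1 spaces by simp
  have int: "integrable ?P h" "integrable ?Q h" "integrable ?mu h"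
    if "h \<in> borel_measurable ?R" "\<And>p. p \<in> M \<Longrightarrow> \<bar>h p\<bar> \<le> L" for h :: "'a \<Rightarrow> real" and L
  proof -
    have "h \<in> borel_measurable ?P" "h \<in> borel_measurable ?Q" "h \<in> borel_measurable ?mu"
      using that(1) measurable_restrict_mono[OF that(1) \<open>T \<subseteq> M\<close>]
      by (simp_all add: weighted_def measurable_cong_sets[OF lam refl]
          measurable_cong_sets[OF sig refl] measurable_cong_sets[OF sets_mu refl])
    moreover have "AE p in ?P. norm (h p) \<le> L" "AE p in ?Q. norm (h p) \<le> L" "AE p in ?mu. norm (h p) \<le> L"
      using that(2) spaces \<open>T \<subseteq> M\<close> by (auto intro!: AE_I2)
    ultimately show "integrable ?P h" "integrable ?Q h" "integrable ?mu h"
      by - (rule P.integrable_const_bound Q.integrable_const_bound mu.integrable_const_bound;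
          assumption)+
  qed
  have nonneg: "(\<integral>p. h p \<partial>?mu) = (\<integral>p. h p \<partial>?P) + (\<integral>p. h p \<partial>?Q)"
    if h: "h \<in> borel_measurable ?R" "\<And>p. p \<in> M \<Longrightarrow> \<bar>h p\<bar> \<le> L" and pos: "\<And>p. p \<in> M \<Longrightarrow> 0 \<le> h p"
    for h :: "'a \<Rightarrow> real" and L
  proof -
    have ae: "AE p in ?P. 0 \<le> h p" "AE p in ?Q. 0 \<le> h p" "AE p in ?mu. 0 \<le> h p"
      using pos spaces \<open>T \<subseteq> M\<close> by (auto intro!: AE_I2)
    have "(\<integral>\<^sup>+p. ennreal (h p) \<partial>?mu) = (\<integral>\<^sup>+p. ennreal (h p) \<partial>?P) + (\<integral>\<^sup>+p. ennreal (h p) \<partial>?Q)"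
      using h(1) by (intro nn_integral_sum_measure[OF lam sig \<open>T \<subseteq> M\<close> \<alpha> \<beta> nz]) measurable
    then show ?thesis
      using int[OF h] ae
      by (simp add: nn_integral_eq_integral integral_nonneg_AE flip: ennreal_plus)
  qed
  have "(\<integral>p. f p + K \<partial>?mu) = (\<integral>p. f p + K \<partial>?P) + (\<integral>p. f p + K \<partial>?Q)"
    using f bound by (intro nonneg[of _ "2 * K"]) (force simp: abs_le_iff)+
  moreover have "(\<integral>p. \<bar>K\<bar> \<partial>?mu) = (\<integral>p. \<bar>K\<bar> \<partial>?P) + (\<integral>p. \<bar>K\<bar> \<partial>?Q)"
    by (intro nonneg[of _ "\<bar>K\<bar>"]) auto
  then have "(\<integral>p. K \<partial>?mu) = (\<integral>p. K \<partial>?P) + (\<integral>p. K \<partial>?Q)"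
    by (cases "0 \<le> K") auto
  moreover have "integrable ?P f" "integrable ?Q f" "integrable ?mu f"
    using int[OF f bound] by blast+
  ultimately show ?thesis
    by (simp only: Bochner_Integration.integral_add P.integrable_const Q.integrable_const
        mu.integrable_const)
qed

section \<open>Boundedness of the trace\<close>

lemma C1_norm_nonneg:
  assumes "riemannian_atlas H M \<A>" "space \<nu> \<subseteq> M"
  shows "0 \<le> C1_norm \<nu> \<A> f"
  using grad_sq_nonneg[OF assms(1)] assms(2) by (auto simp: C1_norm_def intro!: add_nonneg_nonneg Bochner_Integration.integral_nonneg)

text \<open>The constant sequence \<open>f, f, \<dots>\<close> is an admissible approximation of \<open>f\<close>, so its norm competes in
  the infimum that defines the norm of the closure.\<close>

lemma C1_fun_in_W12:
  assumes atl: "riemannian_atlas half_space M \<A>" and \<nu>: "sets \<nu> = sets (restrict_space borel M)"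
    and f: "f \<in> C1_fun \<A>"
  shows "f \<in> W12 \<nu> \<A>" "W12_norm \<nu> \<A> f \<le> C1_norm \<nu> \<A> f"
proof -
  have sp: "space \<nu> = M" using sets_eq_imp_space_eq[OF \<nu>] by (simp add: space_restrict_space)
  have "grad_sq \<A> (\<lambda>q. f q - f q) p = 0" if "p \<in> M" for p
    using grad_sq_scale[OF atl that f, of 0] by simp
  then have "(\<integral>\<^sup>+p. ennreal (grad_sq \<A> (\<lambda>q. f q - f q) p) \<partial>\<nu>) = (\<integral>\<^sup>+p. 0 \<partial>\<nu>)"
    using sp by (intro nn_integral_cong) auto
  then have approx: "sobolev_approx \<nu> \<A> (\<lambda>_. f) f"
    using f by (simp add: sobolev_approx_def)
  have "f \<in> borel_measurable \<nu>"
    using borel_measurable_continuous_on_restrict[OF C1_fun_continuous_on[OF atl f]]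
      measurable_cong_sets[OF \<nu>] by blast
  then show "f \<in> W12 \<nu> \<A>" using approx by (auto simp: W12_def)
  have "bdd_below {r. \<exists>g. sobolev_approx \<nu> \<A> g f \<and> (\<lambda>n. C1_norm \<nu> \<A> (g n)) \<longlonglongrightarrow> r}"
  proof (rule bdd_belowI, clarify)
    fix r g assume "(\<lambda>n. C1_norm \<nu> \<A> (g n)) \<longlonglongrightarrow> r"
    then show "0 \<le> r"
      using C1_norm_nonneg[OF atl, of \<nu>] sp by (intro LIMSEQ_le_const) auto
  qed
  then show "W12_norm \<nu> \<A> f \<le> C1_norm \<nu> \<A> f"
    unfolding W12_norm_def using approx by (intro cInf_lower) auto
qed

text \<open>A compact operator is bounded. If there were no bound, some \<open>f\<^sub>n\<close> would satisfy
  \<open>\<parallel>f\<^sub>n\<parallel>\<^sup>2 > n N(f\<^sub>n)\<close>, where \<open>\<parallel>\<cdot>\<parallel>\<close> is the norm of \<open>L\<^sup>2(\<nu>')\<close> and \<open>N\<close> the squared Sobolev norm.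
  Rescaled to \<open>\<parallel>g\<^sub>n\<parallel>\<^sup>2 = n\<close>, they have \<open>N(g\<^sub>n) \<le> 1\<close>, so the traces of a subsequence
  converge in \<open>L\<^sup>2(\<nu>')\<close>, whereas their norms are unbounded. Normalizing the trace rather than the
  Sobolev norm covers the case \<open>N(f\<^sub>n) = 0\<close> as well. This
  scaling uses that \<open>C\<^sup>1\<close> functions are their own traces.\<close>

lemma compact_trace_bounded:
  assumes atl: "riemannian_atlas half_space M \<A>" and \<nu>: "sets \<nu> = sets (restrict_space borel M)"
    and \<nu>': "sets \<nu>' = sets (restrict_space borel N)" "N \<subseteq> M"
    and tr: "compact_trace \<nu> \<A> \<nu>'"
  obtains K where "0 \<le> K"
    "\<And>f. f \<in> C1_fun \<A> \<Longrightarrow> (\<integral>p. (f p)\<^sup>2 \<partial>\<nu>') \<le> K * ((\<integral>p. (f p)\<^sup>2 \<partial>\<nu>) + (\<integral>p. grad_sq \<A> f p \<partial>\<nu>))"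
proof (rule ccontr)
  let ?N = "\<lambda>f. (\<integral>p. (f p)\<^sup>2 \<partial>\<nu>) + (\<integral>p. grad_sq \<A> f p \<partial>\<nu>)" and ?s = "\<lambda>f. \<integral>p. (f p)\<^sup>2 \<partial>\<nu>'"
  assume "\<not> thesis"
  then have "\<not> (\<forall>f\<in>C1_fun \<A>. ?s f \<le> real n * ?N f)" for n :: nat
    using that[of "real n"] of_nat_0_le_iff by blast
  then have "\<exists>f\<in>C1_fun \<A>. real n * ?N f < ?s f" for n :: nat
    by (simp add: not_le)
  then obtain f where f: "\<And>n. f n \<in> C1_fun \<A>" "\<And>n. real n * ?N (f n) < ?s (f n)"
    by metis
  have sp: "space \<nu> = M" using sets_eq_imp_space_eq[OF \<nu>] by (simp add: space_restrict_space)
  have N_nonneg: "0 \<le> ?N h" for h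
    by (intro add_nonneg_nonneg Bochner_Integration.integral_nonneg grad_sq_nonneg[OF atl])
      (simp_all add: sp)
  have s_pos: "0 < ?s (f n)" for n
    by (rule le_less_trans[OF mult_nonneg_nonneg[OF of_nat_0_le_iff N_nonneg] f(2)])
  define t where "t n = sqrt (real n / ?s (f n))" for n
  define g where "g n = (\<lambda>p. t n * f n p)" for n
  have t2: "(t n)\<^sup>2 = real n / ?s (f n)" for n
    using s_pos[of n] by (simp add: t_def)
  have g_C1: "g n \<in> C1_fun \<A>" for n unfolding g_def using f(1) by (rule C1_fun_scale)
  have g_s: "?s (g n) = real n" for n
    using s_pos[of n] by (simp add: g_def power_mult_distrib t2)
  have "(\<integral>p. grad_sq \<A> (g n) p \<partial>\<nu>) = (\<integral>p. (t n)\<^sup>2 * grad_sq \<A> (f n) p \<partial>\<nu>)" for n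
    using grad_sq_scale[OF atl _ f(1)] sp by (intro Bochner_Integration.integral_cong) (auto simp: g_def)
  then have "?N (g n) = (t n)\<^sup>2 * ?N (f n)" for n
    by (simp add: g_def power_mult_distrib distrib_left)
  then have "?N (g n) \<le> 1" for n
    using f(2)[of n] s_pos[of n] by (simp add: t2)
  then have "C1_norm \<nu> \<A> (g n) \<le> 1" for n
    by (simp add: C1_norm_def)
  then have g_W: "g n \<in> W12 \<nu> \<A>" "W12_norm \<nu> \<A> (g n) \<le> 1" for n
    using C1_fun_in_W12[OF atl \<nu> g_C1] order_trans by blast+
  obtain T where T: "\<And>h. h \<in> C1_fun \<A> \<Longrightarrow> AE p in \<nu>'. T h p = h p" and comp: "compact_W12_L2 \<nu> \<A> \<nu>' T"
    using tr by (auto simp: compact_trace_def)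
  have "\<exists>(r :: nat \<Rightarrow> nat) v. strict_mono r \<and> v \<in> L2_fun \<nu>' \<and>
      (\<lambda>n. \<integral>p. (T (g (r n)) p - v p)\<^sup>2 \<partial>\<nu>') \<longlonglongrightarrow> 0"
    using comp g_W unfolding compact_W12_L2_def by blast
  then obtain r :: "nat \<Rightarrow> nat" and v where r: "strict_mono r" and v: "v \<in> L2_fun \<nu>'"
    and lim: "(\<lambda>n. \<integral>p. (T (g (r n)) p - v p)\<^sup>2 \<partial>\<nu>') \<longlonglongrightarrow> 0"
    by blast
  have TL2: "T (g n) \<in> L2_fun \<nu>'" for n
    using comp g_W(1) by (simp add: compact_W12_L2_def)
  have g_meas: "g n \<in> borel_measurable \<nu>'" for n
    using measurable_restrict_mono[OF borel_measurable_continuous_on_restrict[OF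
        C1_fun_continuous_on[OF atl g_C1]] \<nu>'(2)] measurable_cong_sets[OF \<nu>'(1)] by blast
  have Ts: "?s (T (g n)) = real n" for n
  proof -
    have "(\<integral>p. (T (g n) p)\<^sup>2 \<partial>\<nu>') = ?s (g n)"
      using g_meas[of n] TL2[of n] T[OF g_C1[of n]]
      by (intro integral_cong_AE) (auto simp: L2_fun_def elim!: eventually_mono)
    then show ?thesis by (simp add: g_s)
  qed
  define V where "V = (\<integral>p. (v p)\<^sup>2 \<partial>\<nu>')"
  have bound: "real n \<le> 2 * (\<integral>p. (T (g n) p - v p)\<^sup>2 \<partial>\<nu>') + 2 * V" for n
  proof -
    define u where "u = T (g n)"
    have u: "u \<in> borel_measurable \<nu>'" "integrable \<nu>' (\<lambda>p. (u p)\<^sup>2)"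
      and v': "v \<in> borel_measurable \<nu>'" "integrable \<nu>' (\<lambda>p. (v p)\<^sup>2)"
      using TL2[of n] v by (auto simp: L2_fun_def u_def)
    have le: "(a - b)\<^sup>2 \<le> 2 * a\<^sup>2 + 2 * b\<^sup>2" "a\<^sup>2 \<le> 2 * (a - b)\<^sup>2 + 2 * b\<^sup>2" for a b :: real
      using zero_le_power2[of "a + b"] zero_le_power2[of "a - 2 * b"]
      by (auto simp: power2_eq_square algebra_simps)
    have d: "integrable \<nu>' (\<lambda>p. (u p - v p)\<^sup>2)"
    proof (rule Bochner_Integration.integrable_bound)
      show "integrable \<nu>' (\<lambda>p. 2 * (u p)\<^sup>2 + 2 * (v p)\<^sup>2)" using u v' by auto
      show "(\<lambda>p. (u p - v p)\<^sup>2) \<in> borel_measurable \<nu>'" using u v' by measurable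
    qed (use le(1) in auto)
    have "(\<integral>p. (u p)\<^sup>2 \<partial>\<nu>') \<le> (\<integral>p. 2 * (u p - v p)\<^sup>2 + 2 * (v p)\<^sup>2 \<partial>\<nu>')"
      using u v' d le(2) by (intro integral_mono) auto
    also have "\<dots> = 2 * (\<integral>p. (u p - v p)\<^sup>2 \<partial>\<nu>') + 2 * V"
      using v' d by (simp add: V_def)
    finally show ?thesis using Ts[of n] by (simp add: u_def)
  qed
  have "\<forall>\<^sub>F n in sequentially. (\<integral>p. (T (g (r n)) p - v p)\<^sup>2 \<partial>\<nu>') < 1"
    using order_tendstoD(2)[OF lim] by simp
  then obtain n0 where n0: "\<And>n. n \<ge> n0 \<Longrightarrow> (\<integral>p. (T (g (r n)) p - v p)\<^sup>2 \<partial>\<nu>') < 1"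
    by (auto simp: eventually_sequentially)
  obtain m where m: "2 + 2 * V < real m" using reals_Archimedean2 by blast
  define n where "n = max n0 m"
  have "real m \<le> real (r n)"
    using seq_suble[OF r, of n] by (simp add: n_def)
  then show False
    using bound[of "r n"] n0[of n] m by (simp add: n_def)
qed


section \<open>The Poincare inequality\<close>

lemma smallest_const_finite:
  assumes "smallest_const S F G < \<infinity>"
  obtains c where "0 \<le> c" "\<And>f. f \<in> S \<Longrightarrow> F f \<le> c * G f"
proof -
  have "{ereal c | c. 0 \<le> c \<and> (\<forall>f\<in>S. F f \<le> c * G f)} \<noteq> {}"
    using assms unfolding smallest_const_def by (metis Inf_empty less_irrefl top_ereal_def)
  then show thesis using that by blast
qed

theorem proposition2p1:
  fixes \<Omega> :: "'a::t2_space set"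
    and \<A> :: "('a, real \<times> 'b::euclidean_space) rchart set"
    and \<alpha> \<beta> :: "'a \<Rightarrow> real"
    and lam sig mu lam_\<alpha> sig_\<beta> :: "'a measure"
    and A B :: real and d :: nat
  assumes dim: "d = DIM(real \<times> 'b)" "2 \<le> d"
    and manifold: "riemannian_atlas half_space \<Omega> \<A>" "compact \<Omega>" "connected \<Omega>"
    and boundary: "connected (bdry \<A>)"
    and lam: "is_volume_measure \<Omega> \<A> lam"
    and sig: "sig = surface_measure \<Omega> \<A>"
    and A: "A = (\<integral>p. \<alpha> p \<partial>lam)"
    and B: "B = (\<integral>p. \<beta> p \<partial>sig)"
    and lam_\<alpha>: "lam_\<alpha> = weighted lam (\<lambda>p. \<alpha> p / A)"
    and sig_\<beta>: "sig_\<beta> = weighted sig (\<lambda>p. \<beta> p / B)"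
    and mu: "mu = sum_measure \<Omega> \<alpha> lam \<beta> sig"
    and prob: "prob_space mu" "A \<in> {0<..<1}" "B \<in> {0<..<1}" "A + B = 1"
    and weights: "continuous_on \<Omega> \<alpha>" "continuous_on \<Omega> \<beta>"
      "AE p in lam. 0 < \<alpha> p" "AE p in sig. 0 < \<beta> p"
      "(\<lambda>p. sqrt (\<alpha> p)) \<in> W12 lam \<A>" "(\<lambda>p. sqrt (\<beta> p)) \<in> W12 sig (bdry_atlas \<A>)"
    and constants:
      "poincare_const lam_\<alpha> \<A> < \<infinity>" "log_sobolev_const lam_\<alpha> \<A> < \<infinity>"
      "poincare_const sig_\<beta> (bdry_atlas \<A>) < \<infinity>" "log_sobolev_const sig_\<beta> (bdry_atlas \<A>) < \<infinity>"
    and embeddings: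
      "compact_embedding (weighted lam \<alpha>) \<A>"
      "\<forall>s::real. 2 \<le> s \<and> (d = 2 \<or> s \<le> (2 * real d - 2) / (real d - 2)) \<longrightarrow>
         continuous_embedding_Lp (weighted lam \<alpha>) \<A> s (weighted lam \<beta>)"
      "compact_embedding (weighted sig \<beta>) (bdry_atlas \<A>)"
      "compact_trace (weighted lam \<alpha>) \<A> (weighted sig \<beta>)"
  shows "\<exists>C_\<mu>::real. \<forall>f\<in>C1_fun \<A>.
    var_of mu f \<le> C_\<mu> * ((\<integral>p. grad_sq \<A> f p \<partial>weighted lam \<alpha>) +
                        (\<integral>p. grad_sq (bdry_atlas \<A>) f p \<partial>weighted sig \<beta>))"
proof -
  let ?P = "weighted lam \<alpha>" and ?Q = "weighted sig \<beta>"
  let ?Gl = "\<lambda>f. \<integral>p. grad_sq \<A> f p \<partial>?P"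
    and ?Gs = "\<lambda>f. \<integral>p. grad_sq (bdry_atlas \<A>) f p \<partial>?Q"
  note atl = manifold(1)
  have AB: "0 < A" "A < 1" "0 < B" "B < 1" using prob(2,3) by auto

  have sets_lam: "sets lam = sets (restrict_space borel \<Omega>)"
    using lam by (simp add: is_volume_measure_def)
  have sets_sig: "sets sig = sets (restrict_space borel (bdry \<A>))"
    using sets.space_closed[of "restrict_space borel (bdry \<A>)"]
      sets.sigma_sets_eq[of "restrict_space borel (bdry \<A>)"]
    by (simp add: sig surface_measure_def space_restrict_space)
  have spaces: "space lam = \<Omega>" "space sig = bdry \<A>"
    using sets_eq_imp_space_eq[OF sets_lam] sets_eq_imp_space_eq[OF sets_sig]
    by (auto simp: space_restrict_space)
  note bdry = bdry_subset[OF atl]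
  have int_\<alpha>: "integrable lam \<alpha>"
    by (rule ccontr) (use A AB in \<open>simp add: not_integrable_integral_eq\<close>)
  have int_\<beta>: "integrable sig \<beta>"
    by (rule ccontr) (use B AB in \<open>simp add: not_integrable_integral_eq\<close>)
  have pos: "AE p in lam. 0 \<le> \<alpha> p" "AE p in sig. 0 \<le> \<beta> p"
    using weights(3,4) by auto
  have scale: "(\<integral>p. h p \<partial>lam_\<alpha>) = (\<integral>p. h p \<partial>?P) / A" "(\<integral>p. h p \<partial>sig_\<beta>) = (\<integral>p. h p \<partial>?Q) / B"
    for h :: "'a \<Rightarrow> real"
    unfolding lam_\<alpha> sig_\<beta> using int_\<alpha> int_\<beta> pos AB
    by (auto intro!: integral_weighted_divide)
  have prob_lam: "prob_space lam_\<alpha>" and prob_sig: "prob_space sig_\<beta>"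
    unfolding lam_\<alpha> sig_\<beta> using int_\<alpha> int_\<beta> pos A B AB
    by (auto intro!: prob_space_weighted_divide)
  interpret Pl: prob_space lam_\<alpha> by (rule prob_lam)
  interpret Ps: prob_space sig_\<beta> by (rule prob_sig)
  have fin: "finite_measure ?P" "finite_measure ?Q"
    using emeasure_weighted_space[OF int_\<alpha> pos(1)] emeasure_weighted_space[OF int_\<beta> pos(2)]
    by (auto intro!: finite_measureI simp: weighted_def)

  \<comment> \<open>Continuous functions on the compact manifold are bounded, hence integrable for all three
    measures.\<close>
  have int_lam: "integrable lam_\<alpha> h" and int_sig: "integrable sig_\<beta> h"
    and split: "(\<integral>p. h p \<partial>mu) = A * (\<integral>p. h p \<partial>lam_\<alpha>) + B * (\<integral>p. h p \<partial>sig_\<beta>)"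
    if h: "continuous_on \<Omega> h" for h
  proof -
    have "bounded (h ` \<Omega>)"
      using compact_continuous_image[OF h manifold(2)] by (rule compact_imp_bounded)
    then obtain K where K: "\<And>p. p \<in> \<Omega> \<Longrightarrow> \<bar>h p\<bar> \<le> K" by (auto simp: bounded_iff)
    have meas: "h \<in> borel_measurable (restrict_space borel \<Omega>)"
      using h by (rule borel_measurable_continuous_on_restrict)
    show "integrable lam_\<alpha> h"
      using meas K by (intro Pl.integrable_const_bound[of _ K])
        (auto simp: lam_\<alpha> weighted_def spaces measurable_cong_sets[OF sets_lam refl] intro!: AE_I2)
    show "integrable sig_\<beta> h"
      using measurable_restrict_mono[OF meas bdry] K bdry by (intro Ps.integrable_const_bound[of _ K])
        (auto simp: sig_\<beta> weighted_def spaces measurable_cong_sets[OF sets_sig refl] intro!: AE_I2)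
    have "(\<integral>p. h p \<partial>mu) = (\<integral>p. h p \<partial>?P) + (\<integral>p. h p \<partial>?Q)"
      unfolding mu using int_\<alpha> int_\<beta> prob(1) mu
      by (intro integral_sum_measure[OF sets_lam sets_sig bdry _ _ _ meas K fin]) auto
    then show "(\<integral>p. h p \<partial>mu) = A * (\<integral>p. h p \<partial>lam_\<alpha>) + B * (\<integral>p. h p \<partial>sig_\<beta>)"
      using scale[of h] AB by simp
  qed

  obtain c where c: "0 \<le> c"
    "\<And>f. f \<in> C1_fun \<A> \<Longrightarrow> var_of lam_\<alpha> f \<le> c * (\<integral>p. grad_sq \<A> f p \<partial>lam_\<alpha>)"
    using smallest_const_finite[OF constants(1)[unfolded poincare_const_def]] by blast
  obtain c' where c': "0 \<le> c'"
    "\<And>f. f \<in> C1_fun (bdry_atlas \<A>) \<Longrightarrow>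
      var_of sig_\<beta> f \<le> c' * (\<integral>p. grad_sq (bdry_atlas \<A>) f p \<partial>sig_\<beta>)"
    using smallest_const_finite[OF constants(3)[unfolded poincare_const_def]] by blast
  have "sets ?P = sets (restrict_space borel \<Omega>)" "sets ?Q = sets (restrict_space borel (bdry \<A>))"
    using sets_lam sets_sig by (simp_all add: weighted_def)
  from compact_trace_bounded[OF atl this bdry embeddings(4)]
  obtain K where K: "0 \<le> K"
    "\<And>f. f \<in> C1_fun \<A> \<Longrightarrow> (\<integral>p. (f p)\<^sup>2 \<partial>?Q) \<le> K * ((\<integral>p. (f p)\<^sup>2 \<partial>?P) + ?Gl f)"
    by blast

  define C where "C = c + c' + K * (c + 1)"
  have "var_of mu f \<le> C * (?Gl f + ?Gs f)" if f: "f \<in> C1_fun \<A>" for f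
  proof -
    have cont: "continuous_on \<Omega> f" "continuous_on \<Omega> (\<lambda>p. (f p)\<^sup>2)"
      using C1_fun_continuous_on[OF atl f] by (auto intro: continuous_intros)
    define a where "a = (\<integral>p. f p \<partial>lam_\<alpha>)"
    define b where "b = (\<integral>p. f p \<partial>sig_\<beta>)"
    define V where "V = var_of lam_\<alpha> f"
    define W where "W = var_of sig_\<beta> f"
    have G: "0 \<le> ?Gl f" "0 \<le> ?Gs f"
      using grad_sq_nonneg[OF atl] grad_sq_bdry_nonneg[OF atl]
      by (auto intro!: Bochner_Integration.integral_nonneg simp: weighted_def spaces)
    have V: "A * V \<le> c * ?Gl f"
      using c(2)[OF f] AB by (simp add: V_def scale(1)[of "grad_sq \<A> f"] field_simps)
    have W: "0 \<le> W" "B * W \<le> c' * ?Gs f"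
      using prob_space_var_of_nonneg[OF prob_sig int_sig[OF cont(1)] int_sig[OF cont(2)]]
        c'(2)[OF C1_fun_bdry[OF f atl]] AB
      by (simp_all add: W_def scale(2)[of "grad_sq (bdry_atlas \<A>) f"] field_simps)
    \<comment> \<open>The trace bound is applied to \<open>f - a\<close> with the interior mean \<open>a\<close>: then the \<open>L\<^sup>2\<close> part of the
      Sobolev norm is a variance and is absorbed by the interior Poincare inequality.\<close>
    have mean_lam: "(\<integral>p. (f p - a)\<^sup>2 \<partial>?P) = A * V"
      using prob_space_second_moment_about[OF prob_lam int_lam[OF cont(1)] int_lam[OF cont(2)], of a]
        scale(1)[of "\<lambda>p. (f p - a)\<^sup>2"] AB by (simp add: a_def V_def field_simps)
    have mean_sig: "(\<integral>p. (f p - a)\<^sup>2 \<partial>?Q) = B * (W + (b - a)\<^sup>2)"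
      using prob_space_second_moment_about[OF prob_sig int_sig[OF cont(1)] int_sig[OF cont(2)], of a]
        scale(2)[of "\<lambda>p. (f p - a)\<^sup>2"] AB by (simp add: b_def W_def field_simps)
    have "B * (W + (b - a)\<^sup>2) \<le> K * (A * V + ?Gl f)"
      using K(2)[OF C1_fun_diff_const[OF f, of a]]
      by (simp add: mean_lam mean_sig grad_sq_diff_const)
    moreover have "K * (A * V + ?Gl f) \<le> K * (c + 1) * ?Gl f"
      using mult_left_mono[OF V K(1)] by (simp add: algebra_simps)
    moreover have "0 \<le> B * W" using W AB by simp
    ultimately have means: "B * (b - a)\<^sup>2 \<le> K * (c + 1) * ?Gl f"
      by (simp add: algebra_simps)
    have "var_of mu f = A * V + B * W + A * (B * (b - a)\<^sup>2)"
      using weighted_variance_identity[OF prob(4)]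
      by (simp add: var_of_def V_def W_def split[OF cont(1)] split[OF cont(2)] a_def b_def)
    also have "A * (B * (b - a)\<^sup>2) \<le> B * (b - a)\<^sup>2"
      using AB by (intro mult_left_le_one_le) auto
    finally have "var_of mu f \<le> c * ?Gl f + c' * ?Gs f + K * (c + 1) * ?Gl f"
      using V W means by linarith
    also have "\<dots> \<le> C * (?Gl f + ?Gs f)"
      using mult_nonneg_nonneg[OF c(1) G(2)] mult_nonneg_nonneg[OF c'(1) G(1)]
        mult_nonneg_nonneg[OF mult_nonneg_nonneg[OF K(1), of "c + 1"] G(2)] c(1)
      by (simp add: C_def algebra_simps)
    finally show ?thesis .
  qed
  then show ?thesis by blast
qed

end
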